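(* Let $\mathbf{H}$ be one of $\mathbf{Z}$, $\mathbf{N}$, $\mathbf{N}^+$, and let $\mathfrak{b}^\star$ be the upper Buck density on $\mathbf{H}$. Then $\mathfrak{b}^\star$ is the maximum, with respect to $\preceq$, of both the set $\mathcal{M}^\star(\mathscr{F})$ of all upper densities on $\mathbf{H}$ and the set $\mathcal{M}^\star(\mathscr{F}_2)$ of all upper quasi-densities on $\mathbf{H}$; that is, $\mathfrak{b}^\star$ belongs to each of these two sets, and $\theta^\star\preceq\mathfrak{b}^\star$ for every $\theta^\star$ in it.
   Context: $\mathbf{N}$ is the set of non-negative integers, $\mathbf{N}^+$ the set of positive integers, $\mathcal{P}(\mathbf{H})$ the power set of $\mathbf{H}$. For a set $X$ of integers, $k\cdot X+h:=\{kx+h:x\in X\}$. For $\mu^\star:\mathcal{P}(\mathbf{H})\to\mathbf{R}$ consider: (F1) $\mu^\star(\mathbf{H})=1$; (F2) $\mu^\star(X)\le\mu^\star(Y)$ whenever $X\subseteq Y\subseteq\mathbf{H}$; (F3) $\mu^\star(X\cup Y)\le\mu^\star(X)+\mu^\star(Y)$ for all $X,Y\subseteq\mathbf{H}$; (F4) $\mu^\star(k\cdot X)=\frac1k\mu^\star(X)$ for all $X\subseteq\mathbf{H}$, $k\in\mathbf{N}^+$; (F5) $\mu^\star(X+h)=\mu^\star(X)$ for all $X\subseteq\mathbf{H}$, $h\in\mathbf{N}$. An upper density on $\mathbf{H}$ is a function satisfying (F1)–(F5); an upper quasi-density on $\mathbf{H}$ is a function with $\mu^\star(X)\le1$ for all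 $X\subseteq\mathbf{H}$ satisfying (F1), (F3), (F4), (F5). (The values of any such function lie in $[0,1]$.) For functions $f,g:\mathcal{P}(\mathbf{H})\to\mathbf{R}$, $f\preceq g$ means $f(X)\le g(X)$ for all $X\subseteq\mathbf{H}$. Upper asymptotic density: $\mathsf{d}^\star(S):=\limsup_{n\to\infty}\frac{|S\cap[1,n]|}{n}$ for $S\subseteq\mathbf{Z}$. Upper Buck density on $\mathbf{H}$: $\mathfrak{b}^\star(X):=\inf\{\mathsf{d}^\star(S): S\in\mathscr{A},\ X\subseteq S\}$ for $X\subseteq\mathbf{H}$, where $\mathscr{A}$ is the collection of all finite unions of sets of the form $k\cdot\mathbf{Z}+h$ with $k\in\mathbf{N}^+$, $h\in\mathbf{Z}$ (i.e., for $\mathbf{H}\ne\mathbf{Z}$ it is the restriction to $\mathcal{P}(\mathbf{H})$ of the upper Buck density on $\mathbf{Z}$). *)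

theory Defs
  imports "HOL-Analysis.Analysis"
begin

definition affine_image :: "int \<Rightarrow> int \<Rightarrow> int set \<Rightarrow> int set" where
  "affine_image k h X = (\<lambda>x. k * x + h) ` X"

definition F1 :: "int set \<Rightarrow> (int set \<Rightarrow> real) \<Rightarrow> bool" where
  "F1 H \<mu> \<longleftrightarrow> \<mu> H = 1"

definition F2 :: "int set \<Rightarrow> (int set \<Rightarrow> real) \<Rightarrow> bool" where
  "F2 H \<mu> \<longleftrightarrow> (\<forall>X Y. X \<subseteq> Y \<and> Y \<subseteq> H \<longrightarrow> \<mu> X \<le> \<mu> Y)"

definition F3 :: "int set \<Rightarrow> (int set \<Rightarrow> real) \<Rightarrow> bool" where
  "F3 H \<mu> \<longleftrightarrow> (\<forall>X Y. X \<subseteq> H \<and> Y \<subseteq> H \<longrightarrow> \<mu> (X \<union> Y) \<le> \<mu> X + \<mu> Y)"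

definition F4 :: "int set \<Rightarrow> (int set \<Rightarrow> real) \<Rightarrow> bool" where
  "F4 H \<mu> \<longleftrightarrow>
    (\<forall>X k::nat. X \<subseteq> H \<and> k > 0 \<longrightarrow> \<mu> (affine_image (int k) 0 X) = 1 / real k * \<mu> X)"

definition F5 :: "int set \<Rightarrow> (int set \<Rightarrow> real) \<Rightarrow> bool" where
  "F5 H \<mu> \<longleftrightarrow> (\<forall>X h::nat. X \<subseteq> H \<longrightarrow> \<mu> (affine_image 1 (int h) X) = \<mu> X)"

(* A function on the power set of H is encoded as a total function that is undefined
   (in the sense of extensional) outside Pow H. *)
definition upper_densities :: "int set \<Rightarrow> (int set \<Rightarrow> real) set" where
  "upper_densities H =
    {\<mu> \<in> extensional (Pow H). F1 H \<mu> \<and> F2 H \<mu> \<and> F3 H \<mu> \<and> F4 H \<mu> \<and> F5 H \<mu>}"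

definition upper_quasi_densities :: "int set \<Rightarrow> (int set \<Rightarrow> real) set" where
  "upper_quasi_densities H =
    {\<mu> \<in> extensional (Pow H). (\<forall>X. X \<subseteq> H \<longrightarrow> \<mu> X \<le> 1) \<and>
       F1 H \<mu> \<and> F3 H \<mu> \<and> F4 H \<mu> \<and> F5 H \<mu>}"

definition density_le :: "int set \<Rightarrow> (int set \<Rightarrow> real) \<Rightarrow> (int set \<Rightarrow> real) \<Rightarrow> bool" where
  "density_le H f g \<longleftrightarrow> (\<forall>X. X \<subseteq> H \<longrightarrow> f X \<le> g X)"

(* The limsup is taken in the extended reals; as the quotients lie in [0,1], so does the
   limsup, and the conversion to the reals loses nothing. The term n = 0 is 0 and irrelevant. *)
definition upper_asymptotic_density :: "int set \<Rightarrow> real" where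
  "upper_asymptotic_density S =
    real_of_ereal (limsup (\<lambda>n::nat. ereal (real (card (S \<inter> {1..int n})) / real n)))"

definition arith_progressions :: "int set set" where
  "arith_progressions = {affine_image k h UNIV | k h. k > 0}"

definition AP_unions :: "int set set" where
  "AP_unions = {\<Union>P | P. finite P \<and> P \<subseteq> arith_progressions}"

(* The infimum is over a nonempty set (UNIV is a competitor) of nonnegative reals. *)
definition upper_Buck_density :: "int set \<Rightarrow> int set \<Rightarrow> real" where
  "upper_Buck_density H =
    (\<lambda>X\<in>Pow H. Inf {upper_asymptotic_density S | S. S \<in> AP_unions \<and> X \<subseteq> S})"

definition is_density_maximum ::
  "int set \<Rightarrow> (int set \<Rightarrow> real) set \<Rightarrow> (int set \<Rightarrow> real) \<Rightarrow> bool" where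
  "is_density_maximum H M f \<longleftrightarrow> f \<in> M \<and> (\<forall>\<theta>\<in>M. density_le H \<theta> f)"

end

theory Submission
  imports Defs
begin

text \<open>
  The whole proof rests on one formula: the upper Buck density of a set \<open>X\<close> is the infimum,
  over all moduli \<open>m > 0\<close>, of the proportion of residue classes modulo \<open>m\<close> that \<open>X\<close> meets.
  Indeed finite unions of arithmetic progressions are exactly the sets that are periodic modulo
  some \<open>m\<close>; the asymptotic density of such a set is its proportion of residue classes; and
  among the sets periodic modulo \<open>m\<close> that contain \<open>X\<close> there is a smallest one, the union
  of the classes met by \<open>X\<close>.

  The axioms of an upper density can then be read off from elementary facts about residues.
  Subadditivity and scaling also use that the proportion can only decrease when the modulus
  is replaced by a multiple, so that any two moduli can be refined to a common one
  (\<open>residue_ratio_mult_le\<close>).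

  For maximality it suffices to bound an upper quasi-density \<open>\<theta>\<close>, since the upper densities form a
  smaller class that contains the Buck density itself. Cut \<open>X\<close> into its intersections with the
  residue classes modulo \<open>m\<close>. By subadditivity \<open>\<theta> X\<close> is at most the sum of the values of \<open>\<theta>\<close> on the pieces.
  Each piece is, up to translation, of the form \<open>m \<cdot> Y\<close>, so that its value is \<open>\<theta> Y / m\<close>, which is at most
  \<open>1 / m\<close> (\<open>quasi_density_class_le\<close>). Hence \<open>\<theta> X\<close> is bounded by the proportion of classes met by
  \<open>X\<close>, for every \<open>m\<close>.
\<close>

section \<open>Residues of a set of integers\<close>

definition residue_set :: "int \<Rightarrow> int set \<Rightarrow> int set" where
  "residue_set m X = (\<lambda>x. x mod m) ` X"

definition residue_ratio :: "int \<Rightarrow> int set \<Rightarrow> real" where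
  "residue_ratio m X = real (card (residue_set m X)) / real_of_int m"

definition periodic_mod :: "int \<Rightarrow> int set \<Rightarrow> bool" where
  "periodic_mod m S \<longleftrightarrow> (\<forall>x y. x mod m = y mod m \<longrightarrow> x \<in> S \<longrightarrow> y \<in> S)"

definition residue_closure :: "int \<Rightarrow> int set \<Rightarrow> int set" where
  "residue_closure m X = {y. y mod m \<in> residue_set m X}"

lemma residue_set_subset: "m > 0 \<Longrightarrow> residue_set m X \<subseteq> {0..<m}"
  by (auto simp: residue_set_def)

lemma finite_residue_set: "m > 0 \<Longrightarrow> finite (residue_set m X)"
  using residue_set_subset finite_subset by blast

lemma residue_ratio_nonneg: "m > 0 \<Longrightarrow> residue_ratio m X \<ge> 0"
  by (simp add: residue_ratio_def)

lemma residue_ratio_mono: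
  assumes "m > 0" "X \<subseteq> Y"
  shows "residue_ratio m X \<le> residue_ratio m Y"
proof -
  have "residue_set m X \<subseteq> residue_set m Y"
    using assms(2) by (auto simp: residue_set_def)
  then have "card (residue_set m X) \<le> card (residue_set m Y)"
    using finite_residue_set[OF assms(1)] by (intro card_mono)
  then show ?thesis
    using assms(1) by (simp add: residue_ratio_def divide_right_mono)
qed

lemma residue_ratio_Un_le:
  assumes "m > 0"
  shows "residue_ratio m (X \<union> Y) \<le> residue_ratio m X + residue_ratio m Y"
proof -
  have "residue_set m (X \<union> Y) = residue_set m X \<union> residue_set m Y"
    by (auto simp: residue_set_def)
  then have "card (residue_set m (X \<union> Y)) \<le> card (residue_set m X) + card (residue_set m Y)"
    by (simp add: card_Un_le)
  then have "real (card (residue_set m (X \<union> Y)))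
      \<le> real (card (residue_set m X)) + real (card (residue_set m Y))"
    by linarith
  then show ?thesis
    using assms by (simp add: residue_ratio_def divide_right_mono flip: add_divide_distrib)
qed

text \<open>Every residue class modulo \<open>m\<close> splits into exactly \<open>n\<close> classes modulo \<open>m * n\<close>, of which
  \<open>X\<close> may meet only some.\<close>
lemma residue_ratio_mult_le:
  assumes "m > 0" "n > 0"
  shows "residue_ratio (m * n) X \<le> residue_ratio m X"
proof -
  have "residue_set (m * n) X \<subseteq> (\<lambda>(r, q). m * q + r) ` (residue_set m X \<times> {0..<n})"
  proof
    fix z assume "z \<in> residue_set (m * n) X"
    then obtain x where x: "x \<in> X" "z = x mod (m * n)"
      by (auto simp: residue_set_def)
    then have "z = m * (x div m mod n) + x mod m"
      using assms by (simp add: zmod_zmult2_eq)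
    then show "z \<in> (\<lambda>(r, q). m * q + r) ` (residue_set m X \<times> {0..<n})"
      using x assms by (intro image_eqI[of _ _ "(x mod m, x div m mod n)"])
        (auto simp: residue_set_def)
  qed
  then have "card (residue_set (m * n) X)
      \<le> card ((\<lambda>(r, q). m * q + r) ` (residue_set m X \<times> {0..<n}))"
    using finite_residue_set[OF assms(1)] by (intro card_mono) auto
  also have "\<dots> \<le> card (residue_set m X \<times> {0..<n})"
    using finite_residue_set[OF assms(1)] by (intro card_image_le) auto
  also have "\<dots> = card (residue_set m X) * nat n"
    by (simp add: card_cartesian_product)
  finally have "real (card (residue_set (m * n) X)) \<le> real (card (residue_set m X) * nat n)"
    by (rule of_nat_mono)
  then have "real (card (residue_set (m * n) X)) \<le> real (card (residue_set m X)) * real_of_int n"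
    using assms by simp
  then show ?thesis
    using assms by (simp add: residue_ratio_def field_simps)
qed

lemma residue_ratio_scale:
  assumes "k > 0" "m > 0"
  shows "residue_ratio (k * m) (affine_image k 0 X) = residue_ratio m X / real_of_int k"
proof -
  have "residue_set (k * m) (affine_image k 0 X) = (\<lambda>r. k * r) ` residue_set m X"
    by (auto simp: residue_set_def affine_image_def image_image)
  moreover have "inj_on (\<lambda>r. k * r) (residue_set m X)"
    using assms by (auto intro: inj_onI)
  ultimately show ?thesis
    using assms by (simp add: residue_ratio_def card_image)
qed

lemma residue_ratio_translate:
  assumes "m > 0"
  shows "residue_ratio m (affine_image 1 h X) = residue_ratio m X"
proof -
  have "residue_set m (affine_image 1 h X) = (\<lambda>r. (r + h) mod m) ` residue_set m X"
    by (auto simp: residue_set_def affine_image_def image_image mod_simps)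
  moreover have "inj_on (\<lambda>r. (r + h) mod m) (residue_set m X)"
  proof (rule inj_onI)
    fix r s assume rs: "r \<in> residue_set m X" "s \<in> residue_set m X"
      and eq: "(r + h) mod m = (s + h) mod m"
    have "(r + h - h) mod m = (s + h - h) mod m"
      using eq by (rule mod_diff_cong) simp
    moreover have "r mod m = r" "s mod m = s"
      using rs by (auto simp: residue_set_def)
    ultimately show "r = s" by simp
  qed
  ultimately show ?thesis
    by (simp add: residue_ratio_def card_image)
qed

section \<open>Finite unions of arithmetic progressions are the periodic sets\<close>

lemma periodic_mod_mult:
  assumes "periodic_mod m S"
  shows "periodic_mod (m * n) S"
proof -
  have "x mod m = y mod m" if "x mod (m * n) = y mod (m * n)" for x y
    using that by (metis dvd_triv_left mod_mod_cancel)
  then show ?thesis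
    using assms unfolding periodic_mod_def by blast
qed

lemma periodic_mod_Un: "periodic_mod m S \<Longrightarrow> periodic_mod m T \<Longrightarrow> periodic_mod m (S \<union> T)"
  unfolding periodic_mod_def by blast

lemma mem_progression_iff: "x \<in> affine_image k h UNIV \<longleftrightarrow> x mod k = h mod k"
proof -
  have "x \<in> affine_image k h UNIV \<longleftrightarrow> k dvd x - h"
    by (auto simp: affine_image_def dvd_def image_iff algebra_simps)
  then show ?thesis
    by (simp add: mod_eq_dvd_iff)
qed

lemma periodic_mod_progression: "periodic_mod k (affine_image k h UNIV)"
  by (simp add: periodic_mod_def mem_progression_iff)

lemma AP_unions_imp_periodic:
  assumes "S \<in> AP_unions"
  shows "\<exists>m>0. periodic_mod m S"
proof -
  obtain P where P: "finite P" "P \<subseteq> arith_progressions" "S = \<Union>P"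
    using assms by (auto simp: AP_unions_def)
  from P(1,2) have "\<exists>m>0. periodic_mod m (\<Union>P)"
  proof (induction P rule: finite_induct)
    case empty
    show ?case by (intro exI[of _ 1]) (simp add: periodic_mod_def)
  next
    case (insert A P)
    then obtain m where m: "m > 0" "periodic_mod m (\<Union>P)" by auto
    obtain k h where k: "k > 0" "A = affine_image k h UNIV"
      using insert.prems by (auto simp: arith_progressions_def)
    have "periodic_mod (k * m) A" "periodic_mod (k * m) (\<Union>P)"
      using periodic_mod_mult[of k A m] periodic_mod_mult[OF m(2), of k]
      by (simp_all add: k(2) periodic_mod_progression mult.commute)
    then have "periodic_mod (k * m) (\<Union>(insert A P))"
      by (simp add: periodic_mod_Un)
    moreover have "k * m > 0" using m(1) k(1) by simp
    ultimately show ?case by blast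
  qed
  then show ?thesis by (simp add: P(3))
qed

lemma residue_closure_in_AP_unions:
  assumes "m > 0"
  shows "residue_closure m X \<in> AP_unions"
proof -
  have "residue_closure m X = \<Union>((\<lambda>r. affine_image m r UNIV) ` residue_set m X)"
    by (auto simp: residue_closure_def mem_progression_iff residue_set_def)
  moreover have "(\<lambda>r. affine_image m r UNIV) ` residue_set m X \<subseteq> arith_progressions"
    using assms by (auto simp: arith_progressions_def)
  ultimately show ?thesis
    using finite_imageI[OF finite_residue_set[OF assms]] unfolding AP_unions_def mem_Collect_eq
    by (intro exI[of _ "(\<lambda>r. affine_image m r UNIV) ` residue_set m X"] conjI)
qed

lemma subset_residue_closure: "X \<subseteq> residue_closure m X"
  by (auto simp: residue_closure_def residue_set_def)

lemma periodic_residue_closure: "periodic_mod m (residue_closure m X)"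
  by (auto simp: periodic_mod_def residue_closure_def)

lemma residue_ratio_closure: "residue_ratio m (residue_closure m X) = residue_ratio m X"
proof -
  have "residue_set m (residue_closure m X) = residue_set m X"
    by (auto simp: residue_closure_def residue_set_def)
  then show ?thesis by (simp add: residue_ratio_def)
qed

section \<open>The asymptotic density of a periodic set\<close>

text \<open>A window of \<open>m\<close> consecutive integers represents every residue exactly once.\<close>
lemma card_periodic_window:
  assumes "m > 0" "periodic_mod m S"
  shows "card (S \<inter> {a<..a + m}) = card (residue_set m S)"
proof -
  have "inj_on (\<lambda>x. x mod m) (S \<inter> {a<..a + m})"
  proof (rule inj_onI)
    fix x y assume xy: "x \<in> S \<inter> {a<..a + m}" "y \<in> S \<inter> {a<..a + m}"
      and "x mod m = y mod m"
    then have "m dvd x - y" by (simp add: mod_eq_dvd_iff)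
    moreover have "\<bar>x - y\<bar> < m" using xy by auto
    ultimately show "x = y"
      using zdvd_imp_le[of m "\<bar>x - y\<bar>"] by (cases "x = y") auto
  qed
  moreover have "(\<lambda>x. x mod m) ` (S \<inter> {a<..a + m}) = residue_set m S"
  proof
    show "residue_set m S \<subseteq> (\<lambda>x. x mod m) ` (S \<inter> {a<..a + m})"
    proof
      fix r assume "r \<in> residue_set m S"
      then obtain x where x: "x \<in> S" "r = x mod m" by (auto simp: residue_set_def)
      \<comment> \<open>The representative of the class of \<open>x\<close> in the window that starts at \<open>a + 1\<close>.\<close>
      define y where "y = a + 1 + (x - (a + 1)) mod m"
      have ymod: "y mod m = x mod m"
        unfolding y_def by (simp add: mod_add_right_eq)
      have "y \<in> S"
        using assms(2) x(1) ymod unfolding periodic_mod_def by metis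
      moreover have "y \<in> {a<..a + m}"
        using assms(1) pos_mod_bound[of m "x - (a + 1)"] pos_mod_sign[of m "x - (a + 1)"]
        unfolding y_def greaterThanAtMost_iff by linarith
      ultimately show "r \<in> (\<lambda>x. x mod m) ` (S \<inter> {a<..a + m})"
        using ymod x(2) by (intro image_eqI[of _ _ y]) auto
    qed
  qed (auto simp: residue_set_def)
  ultimately show ?thesis
    using card_image by metis
qed

lemma card_periodic_initial:
  assumes "m > 0" "periodic_mod m S"
  shows "card (S \<inter> {1..int q * m}) = q * card (residue_set m S)"
proof (induction q)
  case (Suc q)
  let ?a = "int q * m"
  have "{1..b + m} = {1..b} \<union> {b<..b + m}" if "b \<ge> 0" for b
    using that assms(1) by auto
  from this[of ?a] have "{1..int (Suc q) * m} = {1..?a} \<union> {?a<..?a + m}"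
    using assms(1) by (simp add: algebra_simps)
  then have "S \<inter> {1..int (Suc q) * m} = (S \<inter> {1..?a}) \<union> (S \<inter> {?a<..?a + m})"
    by (simp add: Int_Un_distrib)
  moreover have "card ((S \<inter> {1..?a}) \<union> (S \<inter> {?a<..?a + m}))
      = card (S \<inter> {1..?a}) + card (S \<inter> {?a<..?a + m})"
    by (intro card_Un_disjoint) auto
  ultimately show ?case
    using Suc card_periodic_window[OF assms] by simp
qed simp

text \<open>The initial segment of length \<open>n\<close> lies between the full blocks of \<open>n div m\<close> and of
  \<open>n div m + 1\<close> periods, so the count deviates from its mean value by at most the count of one period.\<close>
lemma upper_asymptotic_density_periodic:
  assumes "m > 0" "periodic_mod m S"
  shows "upper_asymptotic_density S = residue_ratio m S"
proof -
  define c where "c = card (residue_set m S)"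
  define f where "f = (\<lambda>n::nat. real (card (S \<inter> {1..int n})) / real n)"
  have bounds: "real c / real_of_int m - real c / real n \<le> f n \<and>
      f n \<le> real c / real_of_int m + real c / real n" if "n > 0" for n
  proof -
    define q where "q = n div nat m"
    have n: "int n = int q * m + int n mod m"
      using assms(1) by (simp add: q_def zdiv_int)
    have q1: "int q * m \<le> int n"
      using n pos_mod_sign[OF assms(1), of "int n"] by linarith
    have q2: "int n \<le> int (Suc q) * m"
      using n pos_mod_bound[OF assms(1), of "int n"] by (simp add: algebra_simps)
    have "card (S \<inter> {1..int q * m}) \<le> card (S \<inter> {1..int n})"
      using q1 by (intro card_mono) auto
    then have "real (q * c) \<le> real (card (S \<inter> {1..int n}))"
      unfolding c_def card_periodic_initial[OF assms] by (rule of_nat_mono)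
    then have lo: "real q * real c \<le> real (card (S \<inter> {1..int n}))" by simp
    have "card (S \<inter> {1..int n}) \<le> card (S \<inter> {1..int (Suc q) * m})"
      using q2 by (intro card_mono) auto
    then have "real (card (S \<inter> {1..int n})) \<le> real (Suc q * c)"
      unfolding c_def card_periodic_initial[OF assms] by (rule of_nat_mono)
    then have hi: "real (card (S \<inter> {1..int n})) \<le> (real q + 1) * real c"
      by (simp add: algebra_simps)
    have m0: "real_of_int m > 0" using assms(1) by simp
    have "real_of_int (int q * m) \<le> real_of_int (int n)"
      using q1 by (simp only: of_int_le_iff)
    then have "real q \<le> real n / real_of_int m"
      using m0 by (simp add: field_simps)
    then have hi': "(real q + 1) * real c \<le> (real n / real_of_int m + 1) * real c"
      by (intro mult_right_mono) auto
    have "real_of_int (int n) \<le> real_of_int (int (Suc q) * m)"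
      using q2 by (simp only: of_int_le_iff)
    then have "real n / real_of_int m - 1 \<le> real q"
      using m0 by (simp add: field_simps)
    then have lo': "(real n / real_of_int m - 1) * real c \<le> real q * real c"
      by (intro mult_right_mono) auto
    have "(real n / real_of_int m - 1) * real c / real n \<le> f n"
      using lo lo' unfolding f_def by (intro divide_right_mono) auto
    moreover have "f n \<le> (real n / real_of_int m + 1) * real c / real n"
      using hi hi' unfolding f_def by (intro divide_right_mono) auto
    ultimately show ?thesis
      using that m0 by (simp add: field_simps)
  qed
  have err: "(\<lambda>n. real c / real n) \<longlonglongrightarrow> 0"
    by (rule lim_const_over_n)
  have "f \<longlonglongrightarrow> real c / real_of_int m"
  proof (rule tendsto_sandwich)
    show "\<forall>\<^sub>F n in sequentially. real c / real_of_int m - real c / real n \<le> f n"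
      using bounds by (intro eventually_sequentiallyI[of 1]) auto
    show "\<forall>\<^sub>F n in sequentially. f n \<le> real c / real_of_int m + real c / real n"
      using bounds by (intro eventually_sequentiallyI[of 1]) auto
    show "(\<lambda>n. real c / real_of_int m - real c / real n) \<longlonglongrightarrow> real c / real_of_int m"
      using tendsto_diff[OF tendsto_const err] by simp
    show "(\<lambda>n. real c / real_of_int m + real c / real n) \<longlonglongrightarrow> real c / real_of_int m"
      using tendsto_add[OF tendsto_const err] by simp
  qed
  then have "(\<lambda>n. ereal (f n)) \<longlonglongrightarrow> ereal (real c / real_of_int m)"
    by simp
  then have "limsup (\<lambda>n. ereal (f n)) = ereal (real c / real_of_int m)"
    by (intro lim_imp_Limsup) simp_all
  then show ?thesis
    by (simp add: upper_asymptotic_density_def f_def residue_ratio_def c_def)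
qed

section \<open>The Buck density as an infimum of residue proportions\<close>

lemma upper_Buck_density_eq:
  assumes "X \<subseteq> H"
  shows "upper_Buck_density H X = (INF m\<in>{0<..}. residue_ratio m X)"
proof -
  let ?D = "{upper_asymptotic_density S | S. S \<in> AP_unions \<and> X \<subseteq> S}"
  have ratio_in: "residue_ratio m X \<in> ?D" if "m > 0" for m
  proof -
    have "residue_ratio m X = upper_asymptotic_density (residue_closure m X)"
      using upper_asymptotic_density_periodic[OF that periodic_residue_closure]
      by (simp add: residue_ratio_closure)
    then show ?thesis
      using residue_closure_in_AP_unions[OF that] subset_residue_closure by blast
  qed
  have above: "\<exists>m>0. residue_ratio m X \<le> d" if "d \<in> ?D" for d
  proof -
    obtain S where S: "S \<in> AP_unions" "X \<subseteq> S" "d = upper_asymptotic_density S"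
      using \<open>d \<in> ?D\<close> by auto
    obtain m where m: "m > 0" "periodic_mod m S"
      using AP_unions_imp_periodic[OF S(1)] by auto
    have "residue_ratio m X \<le> d"
      using residue_ratio_mono[OF m(1) S(2)] upper_asymptotic_density_periodic[OF m] S(3) by simp
    then show ?thesis using m(1) by blast
  qed
  have "Inf ?D = (INF m\<in>{0<..}. residue_ratio m X)"
  proof (rule antisym)
    have "bdd_below ?D"
      using above residue_ratio_nonneg by (intro bdd_belowI[of _ 0]) (meson order_trans)
    then show "Inf ?D \<le> (INF m\<in>{0<..}. residue_ratio m X)"
      using ratio_in by (intro cINF_greatest cInf_lower) auto
    have bdd: "bdd_below ((\<lambda>m. residue_ratio m X) ` {0<..})"
      using residue_ratio_nonneg by (intro bdd_belowI[of _ 0]) auto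
    show "(INF m\<in>{0<..}. residue_ratio m X) \<le> Inf ?D"
    proof (intro cInf_greatest)
      show "?D \<noteq> {}" using ratio_in[of 1] by force
      show "(INF m\<in>{0<..}. residue_ratio m X) \<le> d" if "d \<in> ?D" for d
        using above[OF that] bdd by (auto intro: cINF_lower2)
    qed
  qed
  then show ?thesis
    using assms by (simp add: upper_Buck_density_def)
qed

lemma upper_Buck_density_le:
  assumes "X \<subseteq> H" "m > 0"
  shows "upper_Buck_density H X \<le> residue_ratio m X"
proof -
  have "bdd_below ((\<lambda>m. residue_ratio m X) ` {0<..})"
    using residue_ratio_nonneg by (intro bdd_belowI[of _ 0]) auto
  then show ?thesis
    using assms by (auto simp: upper_Buck_density_eq intro: cINF_lower)
qed

lemma upper_Buck_density_greatest:
  assumes "X \<subseteq> H" "\<And>m. m > 0 \<Longrightarrow> a \<le> residue_ratio m X"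
  shows "a \<le> upper_Buck_density H X"
  using assms by (auto simp: upper_Buck_density_eq intro!: cINF_greatest)

section \<open>The Buck density is an upper density\<close>

lemma upper_Buck_density_mono:
  assumes "X \<subseteq> Y" "Y \<subseteq> H"
  shows "upper_Buck_density H X \<le> upper_Buck_density H Y"
proof (rule upper_Buck_density_greatest[OF assms(2)])
  fix m :: int assume "m > 0"
  then show "upper_Buck_density H X \<le> residue_ratio m Y"
    using upper_Buck_density_le[OF subset_trans[OF assms], of m] residue_ratio_mono[of m X Y] assms(1)
    by (meson order_trans)
qed

lemma upper_Buck_density_Un_le:
  assumes "X \<subseteq> H" "Y \<subseteq> H"
  shows "upper_Buck_density H (X \<union> Y) \<le> upper_Buck_density H X + upper_Buck_density H Y"
proof -
  have common: "upper_Buck_density H (X \<union> Y) \<le> residue_ratio m X + residue_ratio n Y"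
    if "m > 0" "n > 0" for m n
  proof -
    have "upper_Buck_density H (X \<union> Y) \<le> residue_ratio (m * n) (X \<union> Y)"
      using assms that by (intro upper_Buck_density_le) auto
    also have "\<dots> \<le> residue_ratio (m * n) X + residue_ratio (n * m) Y"
      using residue_ratio_Un_le[of "m * n"] that by (simp add: mult.commute)
    also have "\<dots> \<le> residue_ratio m X + residue_ratio n Y"
      using that by (intro add_mono residue_ratio_mult_le)
    finally show ?thesis .
  qed
  have "upper_Buck_density H (X \<union> Y) - residue_ratio n Y \<le> upper_Buck_density H X"
    if "n > 0" for n
    using common that by (intro upper_Buck_density_greatest[OF assms(1)]) (simp add: algebra_simps)
  then have "upper_Buck_density H (X \<union> Y) - upper_Buck_density H X \<le> upper_Buck_density H Y"
    by (intro upper_Buck_density_greatest[OF assms(2)]) (simp add: algebra_simps)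
  then show ?thesis by simp
qed

text \<open>The classes of \<open>k \<cdot> X\<close> modulo \<open>k * m\<close> correspond to those of \<open>X\<close> modulo \<open>m\<close>, and moduli
  that are multiples of \<open>k\<close> suffice to compute the infimum for \<open>k \<cdot> X\<close>.\<close>
lemma upper_Buck_density_scale:
  assumes "X \<subseteq> H" "affine_image k 0 X \<subseteq> H" "k > 0"
  shows "upper_Buck_density H (affine_image k 0 X) = upper_Buck_density H X / real_of_int k"
proof (rule antisym)
  have "upper_Buck_density H (affine_image k 0 X) * real_of_int k \<le> residue_ratio m X"
    if "m > 0" for m
    using upper_Buck_density_le[OF assms(2), of "k * m"] residue_ratio_scale[OF assms(3) that, of X]
      that assms(3) by (simp add: field_simps)
  then have "upper_Buck_density H (affine_image k 0 X) * real_of_int k \<le> upper_Buck_density H X"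
    by (intro upper_Buck_density_greatest[OF assms(1)])
  then show "upper_Buck_density H (affine_image k 0 X) \<le> upper_Buck_density H X / real_of_int k"
    using assms(3) by (simp add: field_simps)
  show "upper_Buck_density H X / real_of_int k \<le> upper_Buck_density H (affine_image k 0 X)"
  proof (rule upper_Buck_density_greatest[OF assms(2)])
    fix m :: int assume m: "m > 0"
    have "upper_Buck_density H X / real_of_int k \<le> residue_ratio m X / real_of_int k"
      using upper_Buck_density_le[OF assms(1) m] assms(3) by (intro divide_right_mono) auto
    also have "\<dots> = residue_ratio (m * k) (affine_image k 0 X)"
      using residue_ratio_scale[OF assms(3) m, of X] by (simp add: mult.commute)
    also have "\<dots> \<le> residue_ratio m (affine_image k 0 X)"
      by (rule residue_ratio_mult_le[OF m assms(3)])
    finally show "upper_Buck_density H X / real_of_int k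
        \<le> residue_ratio m (affine_image k 0 X)" .
  qed
qed

lemma upper_Buck_density_translate:
  assumes "X \<subseteq> H" "affine_image 1 h X \<subseteq> H"
  shows "upper_Buck_density H (affine_image 1 h X) = upper_Buck_density H X"
  using assms residue_ratio_translate by (simp add: upper_Buck_density_eq)

lemma upper_Buck_density_full:
  assumes "{1..} \<subseteq> H"
  shows "upper_Buck_density H H = 1"
proof -
  have "residue_ratio m H = 1" if "m > 0" for m
  proof -
    have "{0..<m} \<subseteq> residue_set m H"
    proof
      fix r assume r: "r \<in> {0..<m}"
      \<comment> \<open>The shift by \<open>m\<close> is for \<open>r = 0\<close>, which need not lie in \<open>H\<close>.\<close>
      have "r + m \<in> H" using assms r by auto
      moreover have "(r + m) mod m = r" using r by simp
      ultimately show "r \<in> residue_set m H"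
        unfolding residue_set_def by (metis image_eqI)
    qed
    then have "residue_set m H = {0..<m}"
      using residue_set_subset[OF that] by blast
    then show ?thesis
      using that by (simp add: residue_ratio_def)
  qed
  then show ?thesis
    by (simp add: upper_Buck_density_eq)
qed

lemma affine_image_subset_ground:
  assumes "H = UNIV \<or> H = {0..} \<or> H = {1..}" "X \<subseteq> H" "k > 0" "h \<ge> 0"
  shows "affine_image k h X \<subseteq> H"
proof -
  have "k * x + h \<in> H" if "x \<in> H" for x
  proof -
    have "k * x + h \<ge> x" if "x \<ge> 0"
      using mult_right_mono[of 1 k x] assms(3,4) that by simp
    then show ?thesis
      using assms(1) \<open>x \<in> H\<close> by auto
  qed
  then show ?thesis
    using assms(2) by (auto simp: affine_image_def)
qed

lemma upper_Buck_density_in_upper_densities: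
  assumes "H = UNIV \<or> H = {0..} \<or> H = {1..}"
  shows "upper_Buck_density H \<in> upper_densities H"
proof -
  have "upper_Buck_density H \<in> extensional (Pow H)"
    by (simp add: upper_Buck_density_def)
  moreover have "F1 H (upper_Buck_density H)"
    unfolding F1_def using assms by (intro upper_Buck_density_full) auto
  moreover have "F2 H (upper_Buck_density H)"
    unfolding F2_def by (blast intro: upper_Buck_density_mono)
  moreover have "F3 H (upper_Buck_density H)"
    unfolding F3_def by (blast intro: upper_Buck_density_Un_le)
  moreover have "F4 H (upper_Buck_density H)"
    unfolding F4_def
    using upper_Buck_density_scale affine_image_subset_ground[OF assms] by simp
  moreover have "F5 H (upper_Buck_density H)"
    unfolding F5_def
    using upper_Buck_density_translate affine_image_subset_ground[OF assms] by simp
  ultimately show ?thesis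
    by (simp add: upper_densities_def)
qed

lemma upper_densities_subset_quasi: "upper_densities H \<subseteq> upper_quasi_densities H"
proof
  fix \<mu> assume "\<mu> \<in> upper_densities H"
  then have \<mu>: "\<mu> \<in> extensional (Pow H)" "F1 H \<mu>" "F2 H \<mu>" "F3 H \<mu>" "F4 H \<mu>" "F5 H \<mu>"
    by (auto simp: upper_densities_def)
  have "\<mu> X \<le> 1" if "X \<subseteq> H" for X
    using \<mu>(2,3) that unfolding F1_def F2_def by (metis order_refl)
  then show "\<mu> \<in> upper_quasi_densities H"
    using \<mu> by (simp add: upper_quasi_densities_def)
qed

section \<open>Every upper quasi-density lies below the Buck density\<close>

lemma quasi_density_empty:
  assumes "F4 H \<theta>"
  shows "\<theta> {} = 0"
proof -
  have "\<theta> (affine_image (int 2) 0 {}) = 1 / real 2 * \<theta> {}"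
    using assms unfolding F4_def by (metis empty_subsetI zero_less_numeral)
  then show ?thesis by (simp add: affine_image_def)
qed

text \<open>The elements of the class \<open>r\<close> are \<open>m * y + r\<close>, where the quotients \<open>y\<close> form a set \<open>Y\<close>. On the
  positive integers \<open>y\<close> may be \<open>0\<close>, so \<open>Y\<close> may fall outside the domain of \<open>\<theta>\<close>; translating the class
  by \<open>m\<close> replaces \<open>Y\<close> by \<open>Y + 1\<close> and repairs this for all three ground sets at once.\<close>
lemma quasi_density_class_le:
  assumes H: "H = UNIV \<or> H = {0..} \<or> H = {1..}"
    and \<theta>: "\<theta> \<in> upper_quasi_densities H"
    and X: "X \<subseteq> H" and m: "m > 0" and r: "0 \<le> r"
  shows "\<theta> {x \<in> X. x mod m = r} \<le> 1 / real_of_int m"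
proof -
  define A where "A = {x \<in> X. x mod m = r}"
  define Z where "Z = (\<lambda>x. x div m + 1) ` A"
  have \<theta>': "\<And>X. X \<subseteq> H \<Longrightarrow> \<theta> X \<le> 1" "F4 H \<theta>" "F5 H \<theta>"
    using \<theta> by (auto simp: upper_quasi_densities_def)
  have A: "A \<subseteq> H" using X by (auto simp: A_def)
  have "x div m + 1 \<in> H" if "x \<in> H" for x
    using H that m by (auto simp: pos_imp_zdiv_nonneg_iff)
  then have Z: "Z \<subseteq> H" using A by (auto simp: Z_def)
  have mZ: "affine_image m 0 Z \<subseteq> H"
    using affine_image_subset_ground[OF H Z m] by simp
  have "affine_image 1 m A = affine_image 1 r (affine_image m 0 Z)"
  proof -
    have "x + m = m * (x div m + 1) + r" if "x \<in> A" for x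
      using that mult_div_mod_eq[of m x] by (simp add: A_def algebra_simps)
    then show ?thesis
      by (auto simp: affine_image_def Z_def image_image intro!: image_cong)
  qed
  moreover have shift: "\<theta> (affine_image 1 h B) = \<theta> B" if "B \<subseteq> H" "h \<ge> 0" for B h
    using \<theta>'(3) that unfolding F5_def by (metis nonneg_int_cases)
  ultimately have "\<theta> A = \<theta> (affine_image m 0 Z)"
    using shift[OF A, of m] shift[OF mZ r] m by simp
  also have "\<dots> = 1 / real_of_int m * \<theta> Z"
  proof -
    have "\<theta> (affine_image (int (nat m)) 0 Z) = 1 / real (nat m) * \<theta> Z"
      using \<theta>'(2) Z m unfolding F4_def by (metis zero_less_nat_eq)
    then show ?thesis using m by simp
  qed
  also have "\<dots> \<le> 1 / real_of_int m"
    using \<theta>'(1)[OF Z] m by (simp add: divide_right_mono)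
  finally show ?thesis by (simp add: A_def)
qed

lemma quasi_density_le_residue_ratio:
  assumes H: "H = UNIV \<or> H = {0..} \<or> H = {1..}"
    and \<theta>: "\<theta> \<in> upper_quasi_densities H"
    and X: "X \<subseteq> H" and m: "m > 0"
  shows "\<theta> X \<le> residue_ratio m X"
proof -
  have \<theta>': "F3 H \<theta>" "F4 H \<theta>"
    using \<theta> by (auto simp: upper_quasi_densities_def)
  have union: "\<theta> {x \<in> X. x mod m \<in> R} \<le> real (card R) / real_of_int m"
    if "finite R" "R \<subseteq> {0..}" for R
    using that
  proof (induction R rule: finite_induct)
    case empty
    then show ?case by (simp add: quasi_density_empty[OF \<theta>'(2)])
  next
    case (insert r R)
    have "{x \<in> X. x mod m \<in> insert r R} = {x \<in> X. x mod m = r} \<union> {x \<in> X. x mod m \<in> R}"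
      by auto
    moreover have "{x \<in> X. x mod m = r} \<subseteq> H" "{x \<in> X. x mod m \<in> R} \<subseteq> H"
      using X by auto
    ultimately have "\<theta> {x \<in> X. x mod m \<in> insert r R}
        \<le> \<theta> {x \<in> X. x mod m = r} + \<theta> {x \<in> X. x mod m \<in> R}"
      using \<theta>'(1) unfolding F3_def by simp
    also have "\<dots> \<le> 1 / real_of_int m + real (card R) / real_of_int m"
      using insert quasi_density_class_le[OF H \<theta> X m, of r] by (intro add_mono) auto
    also have "\<dots> = real (card (insert r R)) / real_of_int m"
      using insert.hyps by (simp add: add_divide_distrib)
    finally show ?case .
  qed
  have "{x \<in> X. x mod m \<in> residue_set m X} = X"
    by (auto simp: residue_set_def)
  moreover have "residue_set m X \<subseteq> {0..}"
    using residue_set_subset[OF m, of X] by auto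
  ultimately show ?thesis
    using union[OF finite_residue_set[OF m, of X]] by (simp add: residue_ratio_def)
qed

lemma quasi_density_le_Buck:
  assumes "H = UNIV \<or> H = {0..} \<or> H = {1..}" "\<theta> \<in> upper_quasi_densities H"
  shows "density_le H \<theta> (upper_Buck_density H)"
  unfolding density_le_def
  using quasi_density_le_residue_ratio[OF assms] upper_Buck_density_greatest by blast

theorem theorem3:
  fixes H :: "int set"
  assumes "H = UNIV \<or> H = {0..} \<or> H = {1..}"
  shows "is_density_maximum H (upper_densities H) (upper_Buck_density H) \<and>
         is_density_maximum H (upper_quasi_densities H) (upper_Buck_density H)"
  unfolding is_density_maximum_def
  using upper_Buck_density_in_upper_densities[OF assms] upper_densities_subset_quasi
    quasi_density_le_Buck[OF assms] by blast

end
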